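(* Let $(X,\operatorname{dist})$ be a compact metric space and let $f\colon X\to X$ be a homeomorphism. Then $f$ is expansive if and only if the cyclic group $\langle f\rangle=\{f^n:n\in\mathbb Z\}\subset\mathcal H(X)$ is an expansive group.
   Context: Let $(X,\operatorname{dist})$ be a compact metric space and let $\mathcal H(X)$ denote the group of homeomorphisms of $X$. For $g\in\mathcal H(X)$ put $|g|=\sup_{x\in X}\operatorname{dist}(x,g(x))$. A subgroup $G\subset\mathcal H(X)$ is an expansive group if for all $\epsilon>0$ there is $\delta>0$ such that whenever $x,y\in X$ satisfy $\operatorname{dist}(h(x),h(y))<\delta$ for all $h\in G$, there is $g\in G$ such that $y=g(x)$ and $|g|<\epsilon$. A homeomorphism $f\colon X\to X$ is expansive if there is $\eta>0$ such that whenever $x,y\in X$ and $x\neq y$, one has $\operatorname{dist}(f^n(x),f^n(y))>\eta$ for some $n\in\mathbb Z$. *)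

theory Defs
  imports "HOL-Analysis.Analysis" "HOL-Algebra.Group"
begin

text \<open>The space \<open>X\<close> is a type of class \<^class>\<open>metric_space\<close>; compactness is
  the assumption \<^prop>\<open>compact UNIV\<close>, to be made where needed.\<close>

definition homeo_group :: "('a::metric_space \<Rightarrow> 'a) monoid"
  where "homeo_group =
    \<lparr>carrier = {g. \<exists>h. homeomorphism UNIV UNIV g h}, mult = (\<circ>), one = id\<rparr>"

lemma homeo_group_simps [simp]:
  "g \<in> carrier homeo_group \<longleftrightarrow> (\<exists>h. homeomorphism UNIV UNIV g h)"
  "g \<otimes>\<^bsub>homeo_group\<^esub> h = g \<circ> h"
  "\<one>\<^bsub>homeo_group\<^esub> = id"
  by (simp_all add: homeo_group_def)

lemma group_homeo_group: "group (homeo_group :: ('a::metric_space \<Rightarrow> 'a) monoid)"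
proof (rule groupI)
  fix f g :: "'a \<Rightarrow> 'a"
  assume "f \<in> carrier homeo_group" "g \<in> carrier homeo_group"
  then show "f \<otimes>\<^bsub>homeo_group\<^esub> g \<in> carrier homeo_group"
    by (auto intro: homeomorphism_compose)
next
  show "\<one>\<^bsub>homeo_group\<^esub> \<in> carrier (homeo_group :: ('a \<Rightarrow> 'a) monoid)"
    by (auto simp: homeomorphism_def intro!: exI[of _ id])
next
  fix f :: "'a \<Rightarrow> 'a"
  assume "f \<in> carrier homeo_group"
  then obtain h where h: "homeomorphism UNIV UNIV f h"
    by auto
  then have "homeomorphism UNIV UNIV h f" "h \<circ> f = id"
    by (auto simp: homeomorphism_def)
  then show "\<exists>h\<in>carrier homeo_group. h \<otimes>\<^bsub>homeo_group\<^esub> f = \<one>\<^bsub>homeo_group\<^esub>"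
    by (intro bexI[of _ h]) auto
qed (auto simp: comp_assoc)

text \<open>The quantity \<open>|g|\<close>; the supremum is meaningful whenever the space is bounded.\<close>

definition displacement :: "('a::metric_space \<Rightarrow> 'a) \<Rightarrow> real"
  where "displacement g = (SUP x. dist x (g x))"

definition expansive_group :: "('a::metric_space \<Rightarrow> 'a) set \<Rightarrow> bool"
  where "expansive_group G \<longleftrightarrow> subgroup G homeo_group \<and>
    (\<forall>\<epsilon>>0. \<exists>\<delta>>0. \<forall>x y. (\<forall>h\<in>G. dist (h x) (h y) < \<delta>) \<longrightarrow>
      (\<exists>g\<in>G. y = g x \<and> displacement g < \<epsilon>))"

text \<open>For a homeomorphism \<open>f\<close>, the integer iterate \<open>f\<^sup>n\<close> is the power in
  \<^const>\<open>homeo_group\<close>.\<close>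

definition expansive_homeo :: "('a::metric_space \<Rightarrow> 'a) \<Rightarrow> bool"
  where "expansive_homeo f \<longleftrightarrow> f \<in> carrier homeo_group \<and>
    (\<exists>\<eta>>0. \<forall>x y. x \<noteq> y \<longrightarrow>
      (\<exists>n::int. dist ((f [^]\<^bsub>homeo_group\<^esub> n) x) ((f [^]\<^bsub>homeo_group\<^esub> n) y) > \<eta>))"

definition cyclic_homeos :: "('a::metric_space \<Rightarrow> 'a) \<Rightarrow> ('a \<Rightarrow> 'a) set"
  where "cyclic_homeos f = {f [^]\<^bsub>homeo_group\<^esub> n | n::int. True}"

end

theory Submission
  imports Defs "HOL-Algebra.Elementary_Groups"
begin

text \<open>
  Let \<open>d(x, y) = sup\<^sub>n dist (f\<^sup>n x) (f\<^sup>n y)\<close>, a finer metric for which \<open>f\<close> is an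
  isometry. Expansivity of \<open>f\<close> says that \<open>d\<close> is uniformly discrete; expansivity of the
  group says that \<open>d\<close>-close points are moved to each other by a power of \<open>f\<close> that is
  uniformly close to the identity. If \<open>f\<close> is expansive, \<open>d\<close>-close points coincide and the
  identity serves as that power. Conversely, it suffices that powers of \<open>f\<close> close
  enough to the identity are the identity (\<open>small_times_act_trivially\<close>), for then \<open>d\<close>-close
  points are equal.

  Assume that there are nontrivial powers \<open>f\<^sup>n\<close> arbitrarily close to the identity.
  A small \<open>d\<close>-ball lies in one orbit, so it is countable, and a Baire argument gives
  it a \<open>d\<close>-isolated point; as \<open>f\<close> acts by \<open>d\<close>-isometries, every point is \<open>d\<close>-isolated
  (\<open>orbit_isolated_if_close_in_orbit\<close>). Three consequences follow.

  \<^item> Every point \<open>x\<close> is periodic: a power \<open>f\<^sup>n\<close> close to the identity moves \<open>x\<close> by a small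
    \<open>d\<close>-distance, because it commutes with all the other powers, hence fixes \<open>x\<close>.

  \<^item> On the fixed point set of \<open>f\<^sup>n\<close> with \<open>n \<noteq> 0\<close>, \<open>d\<close> is a maximum over finitely many times, so it
    induces the original topology. That set is therefore compact and discrete, thus finite
    (\<open>finite_fixed_points\<close>), and the whole space is countable.

  \<^item> In a countable compact space some arbitrarily small \<open>s\<close> is at positive distance from all
    values of \<open>dist\<close> (\<open>dist_gap\<close>). A power \<open>f\<^sup>n\<close> that moves points by less than half this gap
    preserves the relation \<open>dist x y < s\<close>. Staying \<open>s\<close>-close for all times thus reduces to
    staying \<open>s\<close>-close for the finitely many times up to \<open>\<bar>n\<bar>\<close>, an open condition
    (\<open>orbit_close_if_window\<close>). So \<open>d\<close>-isolated points are isolated.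

  If all points of a compact space are isolated, the distances between distinct points have a
  positive lower bound, so powers close enough to the identity are the identity, a contradiction.
\<close>

section \<open>Integer actions and the orbit metric\<close>

locale compact_int_action =
  fixes \<phi> :: "int \<Rightarrow> 'a::metric_space \<Rightarrow> 'a"
  assumes compact_space: "compact (UNIV :: 'a set)"
    and continuous: "continuous_on UNIV (\<phi> n)"
    and zero [simp]: "\<phi> 0 x = x"
    and add: "\<phi> (m + n) x = \<phi> m (\<phi> n x)"
begin

text \<open>
  The pointwise strict bound is slightly weaker than \<open>d(x, y) < r\<close>, since a supremum need not be
  attained, but it is the form of closeness in the definition of an expansive group.
\<close>

definition orbit_close :: "real \<Rightarrow> 'a \<Rightarrow> 'a \<Rightarrow> bool"
  where "orbit_close r x y \<longleftrightarrow> (\<forall>n. dist (\<phi> n x) (\<phi> n y) < r)"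

definition orbit_isolated :: "real \<Rightarrow> 'a \<Rightarrow> bool"
  where "orbit_isolated r x \<longleftrightarrow> r > 0 \<and> (\<forall>y. orbit_close r x y \<longrightarrow> y = x)"

definition orbit_cball :: "'a \<Rightarrow> real \<Rightarrow> 'a set"
  where "orbit_cball c r = {z. \<forall>n. dist (\<phi> n c) (\<phi> n z) \<le> r}"

lemma commute: "\<phi> m (\<phi> n x) = \<phi> n (\<phi> m x)"
  by (metis add add.commute)

lemma minus_cancel: "\<phi> (- n) (\<phi> n x) = x"
  by (metis add add.left_inverse zero)

lemma orbit_close_shift: "orbit_close r (\<phi> m x) (\<phi> m y) \<longleftrightarrow> orbit_close r x y"
  unfolding orbit_close_def by (metis add diff_add_cancel)

lemma orbit_isolated_shift:
  assumes "orbit_isolated r (\<phi> m x)"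
  shows "orbit_isolated r x"
  using assms unfolding orbit_isolated_def by (metis orbit_close_shift minus_cancel)

lemma orbit_cball_subset:
  assumes "orbit_close s c c'" "s + t \<le> r"
  shows "orbit_cball c' t \<subseteq> orbit_cball c r"
proof
  fix z assume z: "z \<in> orbit_cball c' t"
  have "dist (\<phi> n c) (\<phi> n z) \<le> r" for n
    using assms z dist_triangle[of "\<phi> n c" "\<phi> n z" "\<phi> n c'"]
    unfolding orbit_cball_def orbit_close_def by (smt (verit) mem_Collect_eq)
  then show "z \<in> orbit_cball c r"
    by (simp add: orbit_cball_def)
qed

lemma orbit_cball_closed: "closed (orbit_cball c r)"
proof -
  have "orbit_cball c r = (\<Inter>n. {z. dist (\<phi> n c) (\<phi> n z) \<le> r})"
    by (auto simp: orbit_cball_def)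
  moreover have "closed {z. dist (\<phi> n c) (\<phi> n z) \<le> r}" for n
    by (intro closed_Collect_le continuous_intros continuous)
  ultimately show ?thesis
    by (simp add: closed_INT)
qed

section \<open>Every point is isolated in the orbit metric\<close>

text \<open>
  The closed \<open>\<delta> / 2\<close>-ball of \<open>d\<close> around \<open>x\<close> is contained in the countable orbit of \<open>x\<close>. If
  \<open>x\<close> were not \<open>d\<close>-isolated, neither would be any point of its orbit, and one could choose
  nested closed \<open>d\<close>-balls in it that avoid the orbit points one after another. Closed \<open>d\<close>-balls
  are closed for the original topology as well, so compactness, in place of completeness of
  \<open>d\<close>, gives a common point, which would lie outside the orbit.
\<close>

lemma orbit_isolated_if_close_in_orbit:
  assumes "\<delta> > 0"
    and close_in_orbit: "\<And>x y. orbit_close \<delta> x y \<Longrightarrow> \<exists>m. y = \<phi> m x"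
  shows "\<exists>r. orbit_isolated r x"
proof (rule ccontr)
  assume not_iso: "\<nexists>r. orbit_isolated r x"
  \<comment> \<open>\<open>Q\<close> describes the admissible pairs of centre and radius; centres have to stay in the orbit
    of \<open>x\<close>, where no point is isolated. \<open>R k\<close> says that the next ball avoids the \<open>k\<close>-th orbit point.\<close>
  define Q where "Q = (\<lambda>(c, r). r > 0 \<and> r \<le> \<delta> / 2 \<and> (\<exists>m. c = \<phi> m x))"
  define y where "y k = \<phi> (from_nat k) x" for k :: nat
  define R where "R = (\<lambda>(k::nat) (c, r) (c', r').
    orbit_cball c' r' \<subseteq> orbit_cball c r \<and> y k \<notin> orbit_cball c' r')"
  have step: "\<exists>p'. Q p' \<and> R k p p'" if Qp: "Q p" for p k
  proof -
    obtain c r m where p: "p = (c, r)" and r: "r > 0" "r \<le> \<delta> / 2" and c: "c = \<phi> m x"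
      using Qp by (auto simp: Q_def split: prod.splits)
    have "\<not> orbit_isolated (r / 2) c"
      using not_iso orbit_isolated_shift unfolding c by blast
    then obtain b where b: "orbit_close (r / 2) c b" "b \<noteq> c"
      using r by (auto simp: orbit_isolated_def)
    \<comment> \<open>At least one of the candidates \<open>c\<close> and \<open>b\<close> for the next centre differs from \<open>y k\<close>.\<close>
    have "orbit_close (r / 2) c c"
      using r by (simp add: orbit_close_def)
    with b obtain c' where c': "orbit_close (r / 2) c c'" "c' \<noteq> y k"
      by metis
    have "orbit_close \<delta> c c'"
      unfolding orbit_close_def
    proof
      fix n
      have "dist (\<phi> n c) (\<phi> n c') < r / 2"
        using c'(1) by (simp add: orbit_close_def)
      with r show "dist (\<phi> n c) (\<phi> n c') < \<delta>"
        by linarith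
    qed
    then have orb: "\<exists>m. c' = \<phi> m x"
      using close_in_orbit unfolding c by (metis add)
    define r' where "r' = min (r / 2) (dist c' (y k) / 2)"
    have r': "r' > 0" "r' \<le> r / 2" "r' < dist c' (y k)"
      using c' r by (auto simp: r'_def min_def)
    have "orbit_cball c' r' \<subseteq> orbit_cball c r"
      using orbit_cball_subset[OF c'(1)] r' by auto
    moreover have "y k \<notin> orbit_cball c' r'"
      using r'(3) by (auto simp: orbit_cball_def intro!: exI[of _ 0])
    ultimately show ?thesis
      using orb r r' by (intro exI[of _ "(c', r')"]) (auto simp: Q_def R_def p)
  qed
  have "Q (x, \<delta> / 2)"
    using \<open>\<delta> > 0\<close> by (auto simp: Q_def intro!: exI[of _ 0])
  then obtain p where p0: "p 0 = (x, \<delta> / 2)" and Q: "\<And>k. Q (p k)" and R: "\<And>k. R k (p k) (p (Suc k))"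
    using dependent_nat_choice[of "\<lambda>k p. (k = 0 \<longrightarrow> p = (x, \<delta> / 2)) \<and> Q p" R] step
    by (metis nat.distinct(1))
  define B where "B k = orbit_cball (fst (p k)) (snd (p k))" for k
  have dec: "B (Suc k) \<subseteq> B k" and avoid: "y k \<notin> B (Suc k)" for k
    using R[of k] by (auto simp: R_def B_def split: prod.splits)
  have "decseq B"
    using dec by (simp add: decseq_Suc_iff)
  have "fst (p k) \<in> B k" for k
    using Q[of k] by (auto simp: Q_def B_def orbit_cball_def split: prod.splits)
  then have nonempty: "B k \<noteq> {}" for k
    by blast
  have "closedin euclidean (B k)" for k
    by (simp add: B_def orbit_cball_closed)
  moreover have "compact_space (euclidean :: 'a topology)"
    using compact_space by (simp add: compact_space_def)
  ultimately have "(\<Inter>k. B k) \<noteq> {}"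
    using nonempty \<open>decseq B\<close>
    by (intro compact_space_imp_nest)
  then obtain z where z: "\<And>k. z \<in> B k"
    by blast
  have "orbit_close \<delta> x z"
    unfolding orbit_close_def
  proof
    fix n
    have "dist (\<phi> n x) (\<phi> n z) \<le> \<delta> / 2"
      using z[of 0] by (simp add: B_def p0 orbit_cball_def)
    with \<open>\<delta> > 0\<close> show "dist (\<phi> n x) (\<phi> n z) < \<delta>"
      by linarith
  qed
  then obtain m where "z = \<phi> m x"
    using close_in_orbit by blast
  then have "z = y (to_nat m)"
    by (simp add: y_def)
  then show False
    using avoid z by blast
qed

section \<open>Reduction to finitely many times\<close>

lemma open_finite_time_close:
  assumes "finite I"
  shows "open {y. \<forall>i\<in>I. dist (\<phi> i x) (\<phi> i y) < r}"
proof -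
  have "{y. \<forall>i\<in>I. dist (\<phi> i x) (\<phi> i y) < r} = (\<Inter>i\<in>I. {y. dist (\<phi> i x) (\<phi> i y) < r})"
    by auto
  moreover have "open {y. dist (\<phi> i x) (\<phi> i y) < r}" for i
    by (intro open_Collect_less continuous_intros continuous)
  ultimately show ?thesis
    using assms by auto
qed

text \<open>
  For negative \<open>n\<close> the remainder \<open>k mod n\<close> is negative or zero, so a window of times that serves
  both signs has to be symmetric.
\<close>

lemma mod_in_window: "n \<noteq> 0 \<Longrightarrow> k mod n \<in> {-\<bar>n\<bar>..\<bar>n\<bar>}" for k n :: int
  by (metis abs_le_iff abs_mod_less atLeastAtMost_iff less_imp_le minus_le_iff)

text \<open>
  Writing \<open>k = (k div n) * n + k mod n\<close>, the hypothesis \<open>invariant\<close> reduces time \<open>k\<close> to the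
  remainder. It holds in two situations below: both points are fixed by \<open>\<phi> n\<close>, or
  \<open>\<phi> n\<close> moves no distance across the threshold \<open>s\<close>.
\<close>

lemma orbit_close_if_window:
  assumes "n \<noteq> 0"
    and window: "\<And>i. i \<in> {-\<bar>n\<bar>..\<bar>n\<bar>} \<Longrightarrow> dist (\<phi> i x) (\<phi> i y) < s"
    and invariant: "\<And>i. dist (\<phi> (n + i) x) (\<phi> (n + i) y) < s \<longleftrightarrow> dist (\<phi> i x) (\<phi> i y) < s"
  shows "orbit_close s x y"
  unfolding orbit_close_def
proof
  fix k
  have "dist (\<phi> (j * n + i) x) (\<phi> (j * n + i) y) < s \<longleftrightarrow> dist (\<phi> i x) (\<phi> i y) < s" for i j
  proof (induction j rule: int_induct[where k = 0])
    case (step1 j)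
    then show ?case
      using invariant[of "j * n + i"] by (simp add: algebra_simps)
  next
    case (step2 j)
    then show ?case
      using invariant[of "(j - 1) * n + i"] by (simp add: algebra_simps)
  qed simp
  from this[of "k div n" "k mod n"] show "dist (\<phi> k x) (\<phi> k y) < s"
    using window[OF mod_in_window[OF \<open>n \<noteq> 0\<close>]] by simp
qed

section \<open>Small times act trivially\<close>

text \<open>
  An infinite fixed point set would accumulate at some \<open>x\<close>, itself fixed by \<open>\<phi> n\<close>. A nearby fixed
  point stays close to \<open>x\<close> for the times in one window, hence, by periodicity, for all times,
  contradicting that \<open>x\<close> is isolated for \<open>d\<close>.
\<close>

lemma finite_fixed_points:
  assumes "n \<noteq> 0"
    and isolated: "\<And>x. \<exists>r. orbit_isolated r x"
  shows "finite {x. \<phi> n x = x}"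
proof (rule ccontr)
  assume "infinite {x. \<phi> n x = x}"
  then obtain x where x: "x islimpt {x. \<phi> n x = x}"
    using compact_space unfolding compact_eq_Bolzano_Weierstrass by blast
  have "closed {x. \<phi> n x = x}"
    by (intro closed_Collect_eq continuous_intros continuous)
  with x have fix_x: "\<phi> n x = x"
    by (auto simp: closed_limpt)
  obtain r where r: "orbit_isolated r x"
    using isolated by blast
  let ?V = "{y. \<forall>i\<in>{-\<bar>n\<bar>..\<bar>n\<bar>}. dist (\<phi> i x) (\<phi> i y) < r}"
  have "x \<in> ?V" "open ?V"
    using open_finite_time_close r by (auto simp: orbit_isolated_def)
  from islimptE[OF x this] obtain y where "y \<in> {x. \<phi> n x = x}" and y_V: "y \<in> ?V" and "y \<noteq> x" .
  then have fix_y: "\<phi> n y = y"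
    by simp
  have period: "\<phi> (n + i) x = \<phi> i x" "\<phi> (n + i) y = \<phi> i y" for i
    using add[of i n] fix_x fix_y by (simp_all add: add.commute)
  have "orbit_close r x y"
    using y_V by (intro orbit_close_if_window[OF \<open>n \<noteq> 0\<close>]) (simp_all add: period)
  then show False
    using r \<open>y \<noteq> x\<close> by (auto simp: orbit_isolated_def)
qed

text \<open>
  A countable space has only countably many distances, so all but countably many \<open>s\<close> are not
  distances; compactness of the set of distances turns this into a gap around \<open>s\<close>.
\<close>

lemma dist_gap:
  assumes "countable (UNIV :: 'a set)" and "r > 0"
  obtains s e where "0 < s" "s < r" "e > 0" "\<And>a b :: 'a. \<bar>dist a b - s\<bar> \<ge> e"
proof -
  let ?D = "range (\<lambda>(a :: 'a, b). dist a b)"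
  have "countable ?D"
    using assms(1) by (metis countable_SIGMA countable_image UNIV_Times_UNIV)
  then have "\<not> {0<..<r} \<subseteq> ?D"
    using uncountable_open_interval[of 0 r] \<open>r > 0\<close> countable_subset by blast
  then obtain s where s: "0 < s" "s < r" "s \<notin> ?D"
    by (meson greaterThanLessThan_iff subsetI)
  have "compact (UNIV :: ('a \<times> 'a) set)"
    using compact_Times[OF compact_space compact_space] by simp
  then have "compact ?D"
    by (intro compact_continuous_image) (auto simp: case_prod_beta intro!: continuous_intros)
  then obtain e where "e > 0" "\<forall>t\<in>?D. e \<le> dist s t"
    using separate_point_closed compact_imp_closed s(3) by metis
  then have "\<bar>dist a b - s\<bar> \<ge> e" for a b :: 'a
    by (auto simp: dist_real_def abs_minus_commute)
  with s \<open>e > 0\<close> show ?thesis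
    using that by blast
qed

text \<open>
  The hypothesis is expansivity of the acting group without the bound on the displacement of
  the group element that connects the two points: that bound enters afterwards, when the
  expansive group property is applied once more, to the \<open>\<epsilon>\<close> obtained here.
\<close>

lemma small_times_act_trivially:
  assumes "\<delta> > 0"
    and "\<And>x y. orbit_close \<delta> x y \<Longrightarrow> \<exists>m. y = \<phi> m x"
  shows "\<exists>\<epsilon>>0. \<forall>n. (\<forall>z. dist z (\<phi> n z) < \<epsilon>) \<longrightarrow> (\<forall>z. \<phi> n z = z)"
proof (rule ccontr)
  assume contra: "\<not> ?thesis"
  have rigid: "\<exists>n. n \<noteq> 0 \<and> (\<forall>z. dist z (\<phi> n z) < \<epsilon>) \<and> (\<exists>z. \<phi> n z \<noteq> z)" if "\<epsilon> > 0" for \<epsilon>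
    using contra that by (metis zero)
  have isolated: "\<exists>r. orbit_isolated r x" for x
    using orbit_isolated_if_close_in_orbit assms by blast
  have periodic: "\<exists>n. n \<noteq> 0 \<and> \<phi> n x = x" for x
  proof -
    obtain r where r: "orbit_isolated r x"
      using isolated by blast
    then obtain n where n: "n \<noteq> 0" "\<And>z. dist z (\<phi> n z) < r"
      using rigid unfolding orbit_isolated_def by meson
    have "orbit_close r x (\<phi> n x)"
      using n(2) by (simp add: orbit_close_def commute[of _ n])
    with r n(1) show ?thesis
      by (auto simp: orbit_isolated_def)
  qed
  have "UNIV = (\<Union>n\<in>{n. n \<noteq> 0}. {x. \<phi> n x = x})"
    using periodic by auto
  moreover have "countable (\<Union>n\<in>{n. n \<noteq> 0}. {x. \<phi> n x = x})"
    using finite_fixed_points isolated by (intro countable_UN) (auto intro: countable_finite)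
  ultimately have countable_space: "countable (UNIV :: 'a set)"
    by simp
  have "open {x}" for x :: 'a
  proof -
    obtain r where r: "orbit_isolated r x"
      using isolated by blast
    then obtain s e where s: "0 < s" "s < r" and e: "e > 0" "\<And>a b :: 'a. \<bar>dist a b - s\<bar> \<ge> e"
      using dist_gap countable_space unfolding orbit_isolated_def by metis
    obtain n where n: "n \<noteq> 0" "\<And>z. dist z (\<phi> n z) < e / 2"
      using rigid[of "e / 2"] e(1) by auto
    \<comment> \<open>\<open>\<phi> n\<close> changes distances by less than the gap \<open>e\<close>, so it cannot carry one across \<open>s\<close>.\<close>
    have invariant: "dist (\<phi> n a) (\<phi> n b) < s \<longleftrightarrow> dist a b < s" for a b
    proof -
      have "\<bar>dist (\<phi> n a) (\<phi> n b) - dist a b\<bar> < e"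
        using n(2)[of a] n(2)[of b] by metric
      then show ?thesis
        using e(2)[of a b] e(2)[of "\<phi> n a" "\<phi> n b"] by linarith
    qed
    let ?V = "{y. \<forall>i\<in>{-\<bar>n\<bar>..\<bar>n\<bar>}. dist (\<phi> i x) (\<phi> i y) < s}"
    have "y = x" if "y \<in> ?V" for y
    proof -
      have "orbit_close s x y"
        using that by (intro orbit_close_if_window[OF n(1)]) (simp_all add: add invariant)
      then have "orbit_close r x y"
        using s(2) unfolding orbit_close_def by (meson less_trans)
      with r show ?thesis
        by (auto simp: orbit_isolated_def)
    qed
    then have "?V = {x}"
      using s(1) by auto
    moreover have "open ?V"
      by (simp add: open_finite_time_close)
    ultimately show ?thesis
      by simp
  qed
  \<comment> \<open>A Lebesgue number of the cover by singletons is a positive lower bound for all distances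
    between distinct points.\<close>
  then have singletons_open: "open G" if "G \<in> range (\<lambda>x :: 'a. {x})" for G
    using that by auto
  have "UNIV \<subseteq> \<Union>(range (\<lambda>x :: 'a. {x}))"
    by auto
  from Heine_Borel_lemma[OF compact_space this singletons_open]
  obtain e where e: "e > 0" "\<And>x :: 'a. \<exists>G\<in>range (\<lambda>x. {x}). ball x e \<subseteq> G"
    by (metis UNIV_I)
  obtain n z where n: "dist z (\<phi> n z) < e" "\<phi> n z \<noteq> z"
    using rigid e(1) by blast
  have "z \<in> ball z e" "\<phi> n z \<in> ball z e"
    using e(1) n(1) by auto
  with e(2)[of z] n(2) show False
    by blast
qed

end

section \<open>Powers of a homeomorphism\<close>

lemma dist_le_displacement:
  assumes "compact (UNIV :: 'a::metric_space set)"
  shows "dist x (g x) \<le> displacement (g :: 'a \<Rightarrow> 'a)"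
proof -
  obtain B where "\<And>a b :: 'a. dist a b \<le> B"
    using compact_imp_bounded[OF assms] unfolding bounded_two_points by blast
  then have "bdd_above (range (\<lambda>x. dist x (g x)))"
    by (auto simp: bdd_above_def)
  then show ?thesis
    unfolding displacement_def by (auto intro: cSUP_upper)
qed

lemma displacement_less:
  assumes "compact (UNIV :: 'a::metric_space set)"
    and "displacement (g :: 'a \<Rightarrow> 'a) < \<epsilon>"
  shows "dist x (g x) < \<epsilon>"
  using dist_le_displacement[OF assms(1), of x g] assms(2) by linarith

lemma compact_int_action_powers:
  assumes "compact (UNIV :: 'a::metric_space set)"
    and "(f :: 'a \<Rightarrow> 'a) \<in> carrier homeo_group"
  shows "compact_int_action (\<lambda>n::int. f [^]\<^bsub>homeo_group\<^esub> n)"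
proof -
  interpret group "homeo_group :: ('a \<Rightarrow> 'a) monoid"
    by (rule group_homeo_group)
  show ?thesis
  proof
    fix m n :: int and x
    have "f [^]\<^bsub>homeo_group\<^esub> n \<in> carrier homeo_group"
      using assms(2) by (rule int_pow_closed)
    then show "continuous_on UNIV (f [^]\<^bsub>homeo_group\<^esub> n)"
      by (auto simp: homeomorphism_def)
    show "(f [^]\<^bsub>homeo_group\<^esub> (0::int)) x = x"
      by simp
    show "(f [^]\<^bsub>homeo_group\<^esub> (m + n)) x
        = (f [^]\<^bsub>homeo_group\<^esub> m) ((f [^]\<^bsub>homeo_group\<^esub> n) x)"
      using int_pow_mult[OF assms(2), of m n] by simp
  qed (rule assms(1))
qed

lemma subgroup_cyclic_homeos:
  assumes "f \<in> carrier homeo_group"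
  shows "subgroup (cyclic_homeos f) homeo_group"
proof -
  have "cyclic_homeos f = range (\<lambda>n::int. f [^]\<^bsub>homeo_group\<^esub> n)"
    by (auto simp: cyclic_homeos_def)
  then show ?thesis
    using group.subgroup_of_powers[OF group_homeo_group assms] by simp
qed

theorem corollary3p3:
  fixes f :: "'a::metric_space \<Rightarrow> 'a"
  assumes "compact (UNIV :: 'a set)"
    and "f \<in> carrier homeo_group"
  shows "expansive_homeo f \<longleftrightarrow> expansive_group (cyclic_homeos f)"
proof
  assume "expansive_homeo f"
  then obtain \<eta> where \<eta>: "\<eta> > 0"
    and separated: "\<And>x y. x \<noteq> y \<Longrightarrow> \<exists>n::int. dist ((f [^]\<^bsub>homeo_group\<^esub> n) x) ((f [^]\<^bsub>homeo_group\<^esub> n) y) > \<eta>"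
    unfolding expansive_homeo_def by blast
  have sub: "subgroup (cyclic_homeos f) homeo_group"
    using subgroup_cyclic_homeos assms(2) .
  then have id: "id \<in> cyclic_homeos f"
    using subgroup.one_closed by fastforce
  have "displacement (id :: 'a \<Rightarrow> 'a) = 0"
    by (simp add: displacement_def)
  moreover have "x = y" if "\<forall>h\<in>cyclic_homeos f. dist (h x) (h y) < \<eta>" for x y
  proof (rule ccontr)
    assume "x \<noteq> y"
    then obtain n :: int where "dist ((f [^]\<^bsub>homeo_group\<^esub> n) x) ((f [^]\<^bsub>homeo_group\<^esub> n) y) > \<eta>"
      using separated by blast
    moreover have "f [^]\<^bsub>homeo_group\<^esub> n \<in> cyclic_homeos f"
      by (auto simp: cyclic_homeos_def)
    ultimately show False
      using that less_asym by blast
  qed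
  ultimately show "expansive_group (cyclic_homeos f)"
    unfolding expansive_group_def using sub id \<eta> by (metis id_apply)
next
  assume expansive: "expansive_group (cyclic_homeos f)"
  interpret compact_int_action "\<lambda>n::int. f [^]\<^bsub>homeo_group\<^esub> n"
    by (rule compact_int_action_powers[OF assms])
  \<comment> \<open>The group property is used twice: for an arbitrary \<open>\<epsilon>\<close>, here 1, it yields the \<open>\<epsilon>\<close> below which
    powers of \<open>f\<close> are trivial, and then for this \<open>\<epsilon>\<close> it gives the constant \<open>\<delta>\<close>.\<close>
  have close_in_orbit: "\<exists>\<delta>>0. \<forall>x y. orbit_close \<delta> x y \<longrightarrow>
      (\<exists>n::int. y = (f [^]\<^bsub>homeo_group\<^esub> n) x \<and> displacement (f [^]\<^bsub>homeo_group\<^esub> n) < \<epsilon>)"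
    if "\<epsilon> > 0" for \<epsilon>
  proof -
    have powers: "cyclic_homeos f = range (\<lambda>n::int. f [^]\<^bsub>homeo_group\<^esub> n)"
      by (auto simp: cyclic_homeos_def)
    have "\<exists>\<delta>>0. \<forall>x y. (\<forall>h\<in>cyclic_homeos f. dist (h x) (h y) < \<delta>) \<longrightarrow>
        (\<exists>g\<in>cyclic_homeos f. y = g x \<and> displacement g < \<epsilon>)"
      by (rule expansive[unfolded expansive_group_def, THEN conjunct2, rule_format, OF that])
    then show ?thesis
      by (simp add: powers orbit_close_def)
  qed
  obtain \<epsilon> where "\<epsilon> > 0"
    and trivial: "\<And>n z. \<forall>z. dist z ((f [^]\<^bsub>homeo_group\<^esub> (n::int)) z) < \<epsilon>
      \<Longrightarrow> (f [^]\<^bsub>homeo_group\<^esub> n) z = z"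
    using small_times_act_trivially close_in_orbit[OF zero_less_one] by blast
  obtain \<delta> where "\<delta> > 0" and \<delta>: "\<And>x y. orbit_close \<delta> x y \<Longrightarrow>
      \<exists>n::int. y = (f [^]\<^bsub>homeo_group\<^esub> n) x \<and> displacement (f [^]\<^bsub>homeo_group\<^esub> n) < \<epsilon>"
    using close_in_orbit[OF \<open>\<epsilon> > 0\<close>] by blast
  have "\<exists>n::int. dist ((f [^]\<^bsub>homeo_group\<^esub> n) x) ((f [^]\<^bsub>homeo_group\<^esub> n) y) > \<delta> / 2"
    if "x \<noteq> y" for x y
  proof -
    have "\<not> orbit_close \<delta> x y"
    proof
      assume "orbit_close \<delta> x y"
      then obtain n :: int where n: "y = (f [^]\<^bsub>homeo_group\<^esub> n) x"
          "displacement (f [^]\<^bsub>homeo_group\<^esub> n) < \<epsilon>"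
        using \<delta> by blast
      have "(f [^]\<^bsub>homeo_group\<^esub> n) x = x"
        by (intro trivial allI displacement_less assms(1) n(2))
      with n(1) that show False
        by simp
    qed
    then obtain n :: int where "dist ((f [^]\<^bsub>homeo_group\<^esub> n) x) ((f [^]\<^bsub>homeo_group\<^esub> n) y) \<ge> \<delta>"
      unfolding orbit_close_def by (auto simp: not_less)
    with \<open>\<delta> > 0\<close> show ?thesis
      by (intro exI[of _ n]) linarith
  qed
  with \<open>\<delta> > 0\<close> assms(2) show "expansive_homeo f"
    unfolding expansive_homeo_def by (intro conjI exI[of _ "\<delta> / 2"]) auto
qed

end
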